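(* Let $m,n\ge 0$ be integers and let $$p(z)=c_{m+2n}\prod_{k=1}^{m}(z-x_k)\prod_{k=1}^{n}\left[(z-a_k)^2+b_k^2\right]=\sum_{k=0}^{m+2n}c_kz^k,$$ where $c_{m+2n}$ is a nonzero real number and $x_k\ge 0$, $a_k>0$, $b_k>0$ are real numbers for all $k$. Suppose that all the zeros of $p$ lie in the closed sector $S(\theta)$, where $0\le\theta<\pi/2$, and let $\alpha\in\mathbb{R}$. Then all of the zeros of $$T[p(z)]=\sum_{k=0}^{m+2n}\exp\left(\frac{-\alpha^2k^2}{2}\right)c_kz^k$$ lie in the sector $S(\gamma)$, where $\gamma=\arccos\left(\min\left\{1,\,e^{\alpha^2/2}\cos\theta\right\}\right)$.
   Context: For $0\le\theta<\pi/2$, $S(\theta)=\{z\in\mathbb{C}: |\arg z|\le\theta \text{ or } z=0\}$, where $\arg$ is the principal argument. Empty products equal $1$. *)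

theory Defs
  imports "HOL-Analysis.Analysis" "HOL-Computational_Algebra.Polynomial"
begin

definition sector :: "real \<Rightarrow> complex set" where
  "sector \<theta> = {z. \<bar>Arg z\<bar> \<le> \<theta> \<or> z = 0}"

definition gauss_op :: "real \<Rightarrow> complex poly \<Rightarrow> complex poly" where
  "gauss_op \<alpha> p =
     (\<Sum>k\<le>degree p. monom (complex_of_real (exp (- (\<alpha>\<^sup>2 * (real k)\<^sup>2) / 2)) * coeff p k) k)"

end

theory Submission
  imports Defs "HOL-Real_Asymp.Real_Asymp" "HOL-Computational_Algebra.Fundamental_Theorem_Algebra"
begin

text \<open>
  Multiplying the \<open>k\<close>-th coefficient by \<open>cos (s k)\<close> turns \<open>p\<close> into the mean of its rotations
  \<open>p (cis s * z)\<close> and \<open>p (cis (- s) * z)\<close>, and the Gaussian multiplier is the limit of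
  \<open>cos (\<alpha> k / sqrt N) ^ N\<close>. As in de Bruijn's method, outside the sector given by
  \<open>cos \<gamma> = min 1 (cos \<theta> / cos s)\<close> and off the real axis, the products of the distances of the two
  rotated points to a conjugate pair of nonzero zeros compare strictly and always in the same direction, so the two
  values of \<open>p\<close> have different moduli and cannot cancel. On the negative real axis the alternating
  signs of the coefficients exclude a zero. After \<open>N\<close> steps the accumulated factor
  \<open>cos (\<alpha> / sqrt N) ^ -N\<close> tends to \<open>exp (\<alpha>\<^sup>2 / 2)\<close>.
\<close>

section \<open>Sectors described by the cosine of their half-angle\<close>

text \<open>A sector without \<open>Arg\<close>: the inequality covers the origin with no case
  split, makes closedness immediate, and turns the widening or narrowing of the sector into
  arithmetic on \<open>\<kappa>\<close>.\<close>

definition circular_cone :: "real \<Rightarrow> complex set" where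
  "circular_cone \<kappa> = {z. \<kappa> * cmod z \<le> Re z}"

text \<open>The cosine is strictly decreasing on the interval from 0 to \<open>pi\<close>, and the
  cosine of \<open>Arg z\<close> is \<open>Re z / cmod z\<close>.\<close>

lemma sector_eq_circular_cone:
  assumes "0 \<le> \<theta>" "\<theta> \<le> pi"
  shows "sector \<theta> = circular_cone (cos \<theta>)"
proof (intro set_eqI)
  fix z :: complex
  show "z \<in> sector \<theta> \<longleftrightarrow> z \<in> circular_cone (cos \<theta>)"
  proof (cases "z = 0")
    case False
    have "\<bar>Arg z\<bar> \<le> pi"
      using Arg_bounded[of z] by auto
    then have "\<bar>Arg z\<bar> \<le> \<theta> \<longleftrightarrow> cos \<theta> \<le> cos \<bar>Arg z\<bar>"
      using assms cos_mono_le_eq[of \<theta> "\<bar>Arg z\<bar>"] by simp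
    also have "cos \<bar>Arg z\<bar> = Re z / cmod z"
      using False by (simp add: cos_Arg)
    finally show ?thesis
      using False by (simp add: sector_def circular_cone_def field_simps)
  qed (simp add: sector_def circular_cone_def)
qed

lemma closed_circular_cone: "closed (circular_cone \<kappa>)"
  unfolding circular_cone_def by (intro closed_Collect_le continuous_intros)

lemma circular_cone_antimono: "\<kappa>' \<le> \<kappa> \<Longrightarrow> circular_cone \<kappa> \<subseteq> circular_cone \<kappa>'"
  unfolding circular_cone_def by (auto intro: order_trans[OF mult_right_mono])

section \<open>Coefficient multipliers\<close>

text \<open>A common form for the cosine multipliers, their powers and the Gaussian limit.\<close>

definition mult_op :: "(nat \<Rightarrow> real) \<Rightarrow> complex poly \<Rightarrow> complex poly" where
  "mult_op g p = (\<Sum>k\<le>degree p. monom (complex_of_real (g k) * coeff p k) k)"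

lemma coeff_mult_op [simp]: "coeff (mult_op g p) k = complex_of_real (g k) * coeff p k"
  by (simp add: mult_op_def coeff_sum coeff_eq_0)

lemma gauss_op_eq_mult_op: "gauss_op \<alpha> p = mult_op (\<lambda>k. exp (- ((\<alpha> * real k)\<^sup>2) / 2)) p"
  by (simp add: gauss_op_def mult_op_def power_mult_distrib)

lemma mult_op_smult: "mult_op g (smult c p) = smult c (mult_op g p)"
  by (rule poly_eqI) simp

lemma mult_op_mult_op: "mult_op g (mult_op h p) = mult_op (\<lambda>k. g k * h k) p"
  by (rule poly_eqI) simp

lemma degree_mult_op:
  assumes "g (degree p) \<noteq> 0"
  shows "degree (mult_op g p) = degree p"
proof (rule antisym)
  show "degree (mult_op g p) \<le> degree p"
    by (rule degree_le) (simp add: coeff_eq_0)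
  show "degree p \<le> degree (mult_op g p)"
    using assms by (cases "p = 0") (auto intro!: le_degree)
qed

lemma mult_op_eq_0_iff:
  assumes "g (degree p) \<noteq> 0"
  shows "mult_op g p = 0 \<longleftrightarrow> p = 0"
proof
  assume "mult_op g p = 0"
  then have "coeff (mult_op g p) (degree p) = 0" by simp
  then show "p = 0" using assms by simp
qed (simp add: mult_op_def)

lemma poly_mult_op:
  "poly (mult_op g p) z = (\<Sum>k\<le>degree p. complex_of_real (g k) * coeff p k * z ^ k)"
  by (simp add: mult_op_def poly_sum poly_monom)

text \<open>Euler's formula, applied to each coefficient, turns the cosine multiplier into an
  average of two rotations.\<close>

lemma poly_mult_op_cos:
  "2 * poly (mult_op (\<lambda>k. cos (s * real k)) p) z = poly p (cis s * z) + poly p (cis (- s) * z)"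
proof -
  have "2 * complex_of_real (cos (s * real k)) = cis s ^ k + cis (- s) ^ k" for k
    by (simp add: Complex.DeMoivre complex_eq_iff mult.commute)
  then show ?thesis
    unfolding poly_mult_op poly_altdef[of p] sum_distrib_left sum.distrib[symmetric]
    by (intro sum.cong refl) (simp add: power_mult_distrib ring_distribs flip: mult.assoc)
qed

section \<open>Polynomials with alternating coefficients\<close>

text \<open>Equivalently, \<open>(-1) ^ d\<close> times p(-x) has nonnegative real coefficients.
  Only the parity of \<open>d\<close> matters, and zero coefficients are allowed. Membership in the
  complex set of nonnegative reals records realness and sign at once.\<close>

definition alternating :: "nat \<Rightarrow> complex poly \<Rightarrow> bool" where
  "alternating d p \<longleftrightarrow> (\<forall>k. (-1) ^ (d + k) * coeff p k \<in> \<real>\<^sub>\<ge>\<^sub>0)"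

lemma sum_nonneg_Reals:
  assumes "\<And>i. i \<in> A \<Longrightarrow> f i \<in> \<real>\<^sub>\<ge>\<^sub>0"
  shows "sum f A \<in> \<real>\<^sub>\<ge>\<^sub>0"
  using assms by (induction A rule: infinite_finite_induct) auto

text \<open>After the substitution of -x for x this is the closure of nonnegative coefficients under
  convolution; the signs split because i + (k - i) = k.\<close>

lemma alternating_mult:
  assumes "alternating d p" "alternating e q"
  shows "alternating (d + e) (p * q)"
  unfolding alternating_def
proof
  fix k
  have "(-1) ^ (d + e + k) * coeff (p * q) k =
        (\<Sum>i\<le>k. ((-1) ^ (d + i) * coeff p i) * ((-1) ^ (e + (k - i)) * coeff q (k - i)))"
    unfolding coeff_mult sum_distrib_left
  proof (intro sum.cong refl)
    fix i assume "i \<in> {..k}"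
    then have "(-1) ^ (d + e + k) = ((-1) ^ (d + i) * (-1) ^ (e + (k - i)) :: complex)"
      by (simp add: add_ac flip: power_add)
    then show "(-1) ^ (d + e + k) * (coeff p i * coeff q (k - i)) =
        ((-1) ^ (d + i) * coeff p i) * ((-1) ^ (e + (k - i)) * coeff q (k - i))"
      by (simp only: mult_ac)
  qed
  also have "\<dots> \<in> \<real>\<^sub>\<ge>\<^sub>0"
    using assms unfolding alternating_def
    by (intro sum_nonneg_Reals, intro nonneg_Reals_mult_I[of "(-1) ^ (d + _) * _"]) blast+
  finally show "(-1) ^ (d + e + k) * coeff (p * q) k \<in> \<real>\<^sub>\<ge>\<^sub>0" .
qed

lemma alternating_prod:
  assumes "finite A" "\<And>i. i \<in> A \<Longrightarrow> alternating (d i) (f i)"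
  shows "alternating (sum d A) (prod f A)"
  using assms
proof (induction A rule: finite_induct)
  case empty
  then show ?case by (auto simp: alternating_def coeff_1)
qed (simp add: alternating_mult)

lemma alternating_linear: "0 \<le> x \<Longrightarrow> alternating 1 [:- complex_of_real x, 1:]"
  by (auto simp: alternating_def coeff_pCons split: nat.split)

lemma alternating_quadratic:
  assumes "0 \<le> a"
  shows "alternating 2 ([:- complex_of_real a, 1:]\<^sup>2 + [:(complex_of_real b)\<^sup>2:])"
proof -
  have "[:- complex_of_real a, 1:]\<^sup>2 + [:(complex_of_real b)\<^sup>2:] =
        [:complex_of_real (a\<^sup>2 + b\<^sup>2), - complex_of_real (2 * a), 1:]"
    by (simp add: power2_eq_square)
  then show ?thesis
    using assms
    by (auto simp: alternating_def coeff_pCons split: nat.split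
        simp del: of_real_mult of_real_add of_real_power)
qed

text \<open>Nonnegativity of \<open>g\<close> is asked only up to the degree, because
  \<open>cos (s * real k)\<close> may be negative for larger \<open>k\<close>.\<close>

lemma alternating_mult_op:
  assumes "alternating d p" "\<And>k. k \<le> degree p \<Longrightarrow> 0 \<le> g k"
  shows "alternating d (mult_op g p)"
  unfolding alternating_def
proof
  fix k
  show "(-1) ^ (d + k) * coeff (mult_op g p) k \<in> \<real>\<^sub>\<ge>\<^sub>0"
  proof (cases "k \<le> degree p")
    case True
    have "of_real (g k) * ((-1) ^ (d + k) * coeff p k) \<in> \<real>\<^sub>\<ge>\<^sub>0"
      using assms True unfolding alternating_def
      by (intro nonneg_Reals_mult_I[of "of_real (g k)"]) (simp_all only: nonneg_Reals_of_real_iff)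
    then show ?thesis by (simp add: mult_ac)
  qed (simp add: coeff_eq_0)
qed

lemma alternating_coeff_real:
  assumes "alternating d p"
  shows "coeff p k \<in> \<real>"
proof -
  have "(-1) ^ (d + k) * ((-1) ^ (d + k) * coeff p k) \<in> \<real>"
    using assms unfolding alternating_def
    by (intro Reals_mult[of "(-1) ^ (d + k)"] subsetD[OF nonneg_Reals_subset_Reals, of "_ * coeff p k"])
      (simp, blast)
  then show ?thesis
    by (simp add: mult.assoc[symmetric] flip: power_add mult_2)
qed

text \<open>At a negative point all terms have the same sign up to the common factor
  \<open>(-1) ^ d\<close>, and the leading term does not vanish.\<close>

lemma alternating_neg_not_root:
  assumes "alternating d p" "p \<noteq> 0" "0 < \<rho>"
  shows "poly p (- complex_of_real \<rho>) \<noteq> 0"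
proof -
  define t where "t k = Re ((-1) ^ (d + k) * coeff p k)" for k
  have nonneg: "0 \<le> t k" and eq: "(-1) ^ (d + k) * coeff p k = of_real (t k)" for k
    using assms(1) by (simp_all add: alternating_def complex_nonneg_Reals_iff complex_eq_iff t_def)
  have "(-1) ^ d * poly p (- complex_of_real \<rho>) =
        (\<Sum>k\<le>degree p. ((-1) ^ (d + k) * coeff p k) * complex_of_real \<rho> ^ k)"
    unfolding poly_altdef sum_distrib_left
    by (intro sum.cong refl) (simp add: power_add power_minus[of "complex_of_real \<rho>"] mult_ac)
  also have "\<dots> = of_real (\<Sum>k\<le>degree p. t k * \<rho> ^ k)"
    unfolding eq by simp
  finally have *: "(-1) ^ d * poly p (- complex_of_real \<rho>) = of_real (\<Sum>k\<le>degree p. t k * \<rho> ^ k)" .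
  have "t (degree p) \<noteq> 0"
    using eq[of "degree p"] assms(2) by auto
  then have "0 < t (degree p) * \<rho> ^ degree p"
    using nonneg[of "degree p"] assms(3) by (intro mult_pos_pos) auto
  then have "0 < (\<Sum>k\<le>degree p. t k * \<rho> ^ k)"
    using nonneg assms(3) by (intro sum_pos2[of _ "degree p"]) auto
  then show ?thesis
    using * by (metis mult_zero_right of_real_eq_0_iff less_irrefl)
qed

section \<open>Comparing moduli at two rotated points\<close>

text \<open>For fixed \<open>r\<close> and fixed \<open>cmod w\<close> the right-hand side is a
  quadratic in \<open>Re w\<close>, the only quantity that changes when \<open>w\<close> is
  rotated.\<close>

lemma norm_dist_conj_pair_sq:
  "(cmod (w - r) * cmod (w - cnj r))\<^sup>2 =
   ((cmod w)\<^sup>2 + (cmod r)\<^sup>2)\<^sup>2 - 4 * Re r * Re w * ((cmod w)\<^sup>2 + (cmod r)\<^sup>2)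
     + 4 * (cmod r)\<^sup>2 * (Re w)\<^sup>2 - 4 * (cmod r)\<^sup>2 * (cmod w)\<^sup>2 + 4 * (Re r)\<^sup>2 * (cmod w)\<^sup>2"
  unfolding power_mult_distrib cmod_power2 minus_complex.sel cnj.sel by algebra

text \<open>The two rotated points have real parts with sum \<open>2 * cos s * Re z\<close> and
  difference \<open>2 * sin s * Im z\<close>, so the difference of the two quadratics factors. The
  remaining factor is positive by the AM-GM bound \<open>2 * cmod z * cmod r \<le> M\<close>, the
  cone condition on \<open>r\<close> and the last hypothesis on \<open>z\<close>.\<close>

lemma norm_dist_conj_pair_less:
  fixes z r :: complex
  assumes "0 < s" "s < pi / 2" "0 < \<kappa>" "r \<in> circular_cone \<kappa>" "r \<noteq> 0" "0 < Im z"
    and "cos s * Re z < \<kappa> * cmod z"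
  shows "cmod (cis (- s) * z - r) * cmod (cis (- s) * z - cnj r)
       < cmod (cis s * z - r) * cmod (cis s * z - cnj r)"
proof -
  define M where "M = (cmod z)\<^sup>2 + (cmod r)\<^sup>2"
  have sin: "0 < sin s"
    using assms by (intro sin_gt_zero) auto
  have "0 < cmod r" using assms by simp
  have "2 * (cmod r)\<^sup>2 * (cos s * Re z) < 2 * (cmod r)\<^sup>2 * (\<kappa> * cmod z)"
    using assms by (intro mult_strict_left_mono) auto
  also have "\<dots> = (\<kappa> * cmod r) * (2 * cmod z * cmod r)"
    by (simp add: power2_eq_square)
  also have "\<dots> \<le> (\<kappa> * cmod r) * M"
    using sum_squares_bound[of "cmod z" "cmod r"] assms unfolding M_def by (intro mult_left_mono) auto
  also have "\<dots> \<le> Re r * M"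
    using assms by (intro mult_right_mono) (auto simp: circular_cone_def M_def)
  finally have "0 < 8 * Im z * sin s * (Re r * M - 2 * (cmod r)\<^sup>2 * (cos s * Re z))"
    using assms sin by simp
  also have "\<dots> = (cmod (cis s * z - r) * cmod (cis s * z - cnj r))\<^sup>2
                - (cmod (cis (- s) * z - r) * cmod (cis (- s) * z - cnj r))\<^sup>2"
    unfolding norm_dist_conj_pair_sq
    by (simp add: norm_mult M_def[symmetric]) (simp add: power2_eq_square algebra_simps)
  finally show ?thesis
    by (intro power2_less_imp_less[of _ "cmod (cis s * z - r) * cmod (cis s * z - cnj r)"]) auto
qed

text \<open>Zeros of the polynomial at the origin contribute equal factors, so strictness is asked
  at one index only. The factors of \<open>f\<close> may vanish, since the rotated point on the
  smaller side may itself be a zero.\<close>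

lemma prod_strict_mono_one:
  fixes f g :: "'a \<Rightarrow> real"
  assumes "finite A" "j \<in> A" "f j < g j" "\<And>i. i \<in> A \<Longrightarrow> 0 \<le> f i \<and> f i \<le> g i \<and> 0 < g i"
  shows "prod f A < prod g A"
proof -
  have "f j * prod f (A - {j}) \<le> f j * prod g (A - {j})"
    using assms by (intro mult_left_mono prod_mono) auto
  also have "\<dots> < g j * prod g (A - {j})"
    using assms by (intro mult_strict_right_mono prod_pos) auto
  finally show ?thesis
    using assms by (simp add: prod.remove)
qed

text \<open>Multiplies the comparison for conjugate pairs over all zeros; the nonzero zero
  \<open>r\<close> supplies the strict factor.\<close>

lemma norm_poly_rotate_less:
  fixes p :: "complex poly"
  assumes real: "\<And>k. coeff p k \<in> \<real>" and "p \<noteq> 0"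
    and roots: "\<And>z. poly p z = 0 \<Longrightarrow> z \<in> circular_cone \<kappa>" and "poly p r = 0" "r \<noteq> 0"
    and "0 < s" "s < pi / 2" "0 < \<kappa>" "0 < Im z" "cos s * Re z < \<kappa> * cmod z"
  shows "cmod (poly p (cis (- s) * z)) < cmod (poly p (cis s * z))"
proof -
  obtain root where root: "smult (lead_coeff p) (\<Prod>i<degree p. [:- root i, 1:]) = p"
    using complex_poly_decompose' by blast
  have poly_eq: "poly p w = lead_coeff p * (\<Prod>i<degree p. w - root i)" for w
    by (subst root[symmetric]) (simp add: poly_prod)
  have cnj: "cmod (poly p (cnj w)) = cmod (poly p w)" for w
    using poly_cnj_real[OF real, of w] by (metis complex_mod_cnj)
  define D where "D w i = cmod (w - root i) * cmod (w - cnj (root i))" for w i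
  \<comment> \<open>\<open>p\<close> is real, so \<open>\<bar>p w\<bar> = \<bar>p (cnj w)\<bar>\<close>; this pairs each zero with its conjugate without
    having to match up the enumerated zeros.\<close>
  have D: "(cmod (poly p w))\<^sup>2 = (cmod (lead_coeff p))\<^sup>2 * (\<Prod>i<degree p. D w i)" for w
  proof -
    have "cmod (cnj w - root i) = cmod (w - cnj (root i))" for i
      by (metis complex_cnj_cnj complex_cnj_diff complex_mod_cnj)
    then have "cmod (poly p (cnj w)) = cmod (lead_coeff p) * (\<Prod>i<degree p. cmod (w - cnj (root i)))"
      by (simp add: poly_eq norm_mult flip: prod_norm)
    moreover have "cmod (poly p w) = cmod (lead_coeff p) * (\<Prod>i<degree p. cmod (w - root i))"
      by (simp add: poly_eq norm_mult flip: prod_norm)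
    moreover have "(cmod (poly p w))\<^sup>2 = cmod (poly p w) * cmod (poly p (cnj w))"
      by (simp add: cnj power2_eq_square)
    ultimately show ?thesis
      by (simp add: power2_eq_square D_def prod.distrib)
  qed
  have less: "D (cis (- s) * z) i < D (cis s * z) i" if "i < degree p" "root i \<noteq> 0" for i
  proof -
    have "poly p (root i) = 0"
      using that by (auto simp: poly_eq intro!: prod_zero)
    then show ?thesis
      unfolding D_def using assms that by (intro norm_dist_conj_pair_less) auto
  qed
  have "z \<noteq> 0" using assms by auto
  have "lead_coeff p \<noteq> 0" using assms by simp
  then obtain j where "j < degree p" "root j = r"
    using assms(4) unfolding poly_eq by auto
  have "(\<Prod>i<degree p. D (cis (- s) * z) i) < (\<Prod>i<degree p. D (cis s * z) i)"
  proof (rule prod_strict_mono_one)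
    show "j \<in> {..<degree p}" "D (cis (- s) * z) j < D (cis s * z) j"
      using \<open>j < degree p\<close> \<open>root j = r\<close> less assms by auto
    fix i assume "i \<in> {..<degree p}"
    moreover have "0 \<le> D (cis (- s) * z) i"
      by (simp add: D_def)
    \<comment> \<open>For a zero at the origin both factors equal the square of
      \<open>cmod z\<close>.\<close>
    moreover have "D (cis (- s) * z) i = D (cis s * z) i" "0 < D (cis s * z) i" if "root i = 0"
      using that \<open>z \<noteq> 0\<close> by (simp_all add: D_def norm_mult)
    ultimately show "0 \<le> D (cis (- s) * z) i \<and> D (cis (- s) * z) i \<le> D (cis s * z) i \<and> 0 < D (cis s * z) i"
      using less[of i] by (cases "root i = 0") auto
  qed simp
  then have "(cmod (poly p (cis (- s) * z)))\<^sup>2 < (cmod (poly p (cis s * z)))\<^sup>2"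
    unfolding D using \<open>lead_coeff p \<noteq> 0\<close> by (intro mult_strict_left_mono) auto
  then show ?thesis
    by (rule power2_less_imp_less) simp
qed

section \<open>Cosine multipliers and their powers\<close>

lemma cos_mult_pos:
  assumes "0 \<le> s" "k \<le> d" "s * real d < pi / 2"
  shows "0 < cos (s * real k)"
proof (rule cos_gt_zero_pi)
  have "s * real k \<le> s * real d"
    using assms by (intro mult_left_mono) auto
  then show "s * real k < pi / 2"
    using assms(3) by linarith
  have "0 \<le> s * real k"
    using assms by simp
  then show "- (pi / 2) < s * real k"
    using pi_gt_zero by linarith
qed

text \<open>At a zero of the averaged polynomial the two rotated values of \<open>p\<close> are
  opposite and so have equal moduli, which the strict comparison forbids. The cap at 1 is the
  degenerate cone, the nonnegative real axis.\<close>

lemma roots_mult_op_cos: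
  fixes p :: "complex poly"
  assumes alt: "alternating d p" and "p \<noteq> 0"
    and roots: "\<And>z. poly p z = 0 \<Longrightarrow> z \<in> circular_cone \<kappa>" and "0 < \<kappa>"
    and s: "0 < s" "s < pi / 2" "s * real (degree p) < pi / 2"
    and zero: "poly (mult_op (\<lambda>k. cos (s * real k)) p) z = 0"
  shows "z \<in> circular_cone (min 1 (\<kappa> / cos s))"
proof (rule ccontr)
  let ?q = "mult_op (\<lambda>k. cos (s * real k)) p"
  assume notin: "z \<notin> circular_cone (min 1 (\<kappa> / cos s))"
  have "0 < cos s" using s by (intro cos_gt_zero_pi) auto
  have pos: "0 < cos (s * real k)" if "k \<le> degree p" for k
    using cos_mult_pos[OF _ that s(3)] s by simp
  have alt_q: "alternating d ?q"
    using alt pos by (intro alternating_mult_op) (auto intro: less_imp_le)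
  have "?q \<noteq> 0"
    using pos[of "degree p"] \<open>p \<noteq> 0\<close> by (subst mult_op_eq_0_iff) auto
  have "z \<noteq> 0"
    using notin by (auto simp: circular_cone_def)
  \<comment> \<open>The first bound excludes nonnegative real \<open>z\<close>; the second is what
    the comparison of moduli requires.\<close>
  have notin1: "Re z < cmod z" and notin2: "cos s * Re z < \<kappa> * cmod z"
  proof -
    have *: "Re z < min 1 (\<kappa> / cos s) * cmod z"
      using notin by (simp add: circular_cone_def)
    also have "\<dots> \<le> 1 * cmod z" by (intro mult_right_mono) auto
    finally show "Re z < cmod z" by simp
    note *
    also have "min 1 (\<kappa> / cos s) * cmod z \<le> \<kappa> / cos s * cmod z" by (intro mult_right_mono) auto
    finally show "cos s * Re z < \<kappa> * cmod z"
      using \<open>0 < cos s\<close> by (simp add: field_simps)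
  qed
  have eq: "poly p (cis s * w) = - poly p (cis (- s) * w)" if "poly ?q w = 0" for w
    using poly_mult_op_cos[of s p w] that by (simp add: eq_neg_iff_add_eq_0)
  show False
  proof (cases "\<exists>r. r \<noteq> 0 \<and> poly p r = 0")
    case True
    then obtain r where r: "poly p r = 0" "r \<noteq> 0" by blast
    have contra: False if "poly ?q w = 0" "0 < Im w" "cos s * Re w < \<kappa> * cmod w" for w
      using norm_poly_rotate_less[OF alternating_coeff_real[OF alt] \<open>p \<noteq> 0\<close> roots r s(1,2) \<open>0 < \<kappa>\<close> that(2,3)]
      by (simp add: eq[OF that(1)])
    consider "0 < Im z" | "Im z < 0" | "Im z = 0" by linarith
    then show False
    proof cases
      case 1
      then show False using contra zero notin2 by blast
    next
      case 2
      \<comment> \<open>The coefficients are real, so conjugation moves the zero into the upper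
        half-plane.\<close>
      have "poly ?q (cnj z) = 0"
        using poly_cnj_real[OF alternating_coeff_real[OF alt_q], of z] zero by simp
      then show False using contra[of "cnj z"] 2 notin2 by simp
    next
      case 3
      then have "Re z < 0" using notin1 by (simp add: cmod_eq_Re)
      moreover have "z = - complex_of_real (- Re z)" using 3 by (simp add: complex_eq_iff)
      ultimately show False
        using alternating_neg_not_root[OF alt_q \<open>?q \<noteq> 0\<close>, of "- Re z"] zero by simp
    qed
  next
    case False
    \<comment> \<open>Without a nonzero zero, \<open>p\<close> is a monomial (possibly constant).
      The multiplier only rescales it, so \<open>z\<close> could only be the origin.\<close>
    obtain root where root: "smult (lead_coeff p) (\<Prod>i<degree p. [:- root i, 1:]) = p"
      using complex_poly_decompose' by blast
    have "root i = 0" if "i < degree p" for i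
    proof -
      have "poly p (root i) = 0"
        using that by (subst root[symmetric]) (auto simp: poly_prod intro!: prod_zero)
      then show ?thesis using False by blast
    qed
    then have "p = smult (lead_coeff p) (\<Prod>i<degree p. [:0, 1:])"
      by (subst root[symmetric]) (simp cong: prod.cong_simp)
    then have "p = monom (lead_coeff p) (degree p)"
      by (simp add: monom_altdef)
    then have "coeff p k = coeff (monom (lead_coeff p) (degree p)) k" for k
      by (rule arg_cong)
    then have "coeff p k = 0" if "k \<noteq> degree p" for k
      using that by simp
    then have "?q = monom (of_real (cos (s * real (degree p))) * lead_coeff p) (degree p)"
      by (intro poly_eqI) auto
    then have "of_real (cos (s * real (degree p))) * lead_coeff p * z ^ degree p = 0"
      using zero by (simp add: poly_monom)
    then show False
      using pos[of "degree p"] \<open>z \<noteq> 0\<close> \<open>p \<noteq> 0\<close> by simp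
  qed
qed

text \<open>Iterates the single cosine step. The degree is preserved, so the same bound on
  \<open>s\<close> serves at every stage.\<close>

lemma roots_mult_op_cos_power:
  fixes p :: "complex poly"
  assumes alt: "alternating d p" and "p \<noteq> 0"
    and roots: "\<And>z. poly p z = 0 \<Longrightarrow> z \<in> circular_cone \<kappa>" and \<kappa>: "0 < \<kappa>" "\<kappa> \<le> 1"
    and s: "0 < s" "s < pi / 2" "s * real (degree p) < pi / 2"
  shows "poly (mult_op (\<lambda>k. cos (s * real k) ^ N) p) z = 0 \<Longrightarrow> z \<in> circular_cone (min 1 (\<kappa> / cos s ^ N))"
proof (induction N arbitrary: z)
  case 0
  have "mult_op (\<lambda>k. cos (s * real k) ^ 0) p = p"
    by (rule poly_eqI) simp
  then show ?case using 0 roots \<kappa> by (simp add: min_absorb2)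
next
  case (Suc N)
  let ?p = "mult_op (\<lambda>k. cos (s * real k) ^ N) p"
  have "0 < cos s" using s by (intro cos_gt_zero_pi) auto
  have pos: "0 < cos (s * real k)" if "k \<le> degree p" for k
    using cos_mult_pos[OF _ that s(3)] s by simp
  have deg: "degree ?p = degree p" and "?p \<noteq> 0"
    using pos[of "degree p"] \<open>p \<noteq> 0\<close> by (auto simp: degree_mult_op mult_op_eq_0_iff)
  have "z \<in> circular_cone (min 1 (min 1 (\<kappa> / cos s ^ N) / cos s))"
  proof (rule roots_mult_op_cos)
    show "alternating d ?p"
      using alt pos by (intro alternating_mult_op) (auto intro: less_imp_le)
    show "poly (mult_op (\<lambda>k. cos (s * real k)) ?p) z = 0"
      using Suc.prems by (simp add: mult_op_mult_op)
  qed (use Suc.IH s deg \<open>?p \<noteq> 0\<close> \<open>0 < cos s\<close> \<kappa> in auto)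
  \<comment> \<open>Because \<open>1 / cos s\<close> is at least 1, the inner cap is absorbed by the
    outer one and the factors accumulate as a power.\<close>
  moreover have "min 1 (min 1 (\<kappa> / cos s ^ N) / cos s) = min 1 (\<kappa> / cos s ^ Suc N)"
  proof -
    have "1 \<le> 1 / cos s" using \<open>0 < cos s\<close> by simp
    then have "min 1 (min (1 / cos s) (\<kappa> / cos s ^ N / cos s)) = min 1 (\<kappa> / cos s ^ N / cos s)"
      by (simp add: min.assoc[symmetric] min_absorb1)
    moreover have "min 1 (\<kappa> / cos s ^ N) / cos s = min (1 / cos s) (\<kappa> / cos s ^ N / cos s)"
      using \<open>0 < cos s\<close> by (simp add: min_divide_distrib_right)
    ultimately show ?thesis by (simp add: mult.commute)
  qed
  ultimately show ?case by simp
qed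

section \<open>Passage to the Gaussian multiplier\<close>

text \<open>Each linear factor has modulus at least \<open>\<epsilon>\<close>. This quantitative
  bound survives a limit of polynomials and does the work of Hurwitz's theorem.\<close>

lemma norm_poly_ge_dist_power:
  fixes p :: "complex poly"
  assumes "\<And>w. poly p w = 0 \<Longrightarrow> \<epsilon> \<le> dist z w" "0 \<le> \<epsilon>"
  shows "cmod (lead_coeff p) * \<epsilon> ^ degree p \<le> cmod (poly p z)"
proof -
  obtain root where root: "smult (lead_coeff p) (\<Prod>i<degree p. [:- root i, 1:]) = p"
    using complex_poly_decompose' by blast
  have poly_eq: "poly p w = lead_coeff p * (\<Prod>i<degree p. w - root i)" for w
    by (subst root[symmetric]) (simp add: poly_prod)
  have "(\<Prod>i<degree p. \<epsilon>) \<le> (\<Prod>i<degree p. cmod (z - root i))"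
  proof (rule prod_mono)
    fix i assume "i \<in> {..<degree p}"
    then have "poly p (root i) = 0" by (auto simp: poly_eq intro!: prod_zero)
    then show "0 \<le> \<epsilon> \<and> \<epsilon> \<le> cmod (z - root i)"
      using assms by (simp add: dist_norm)
  qed
  then show ?thesis
    by (simp add: poly_eq[of z] norm_mult mult_left_mono flip: prod_norm)
qed

text \<open>The expansion of the cosine gives 1 - \<beta>^2 / (2 N) + O(1 / N^2), whose N-th power
  converges to the exponential.\<close>

lemma cos_div_sqrt_power_tendsto:
  "(\<lambda>N::nat. cos (\<beta> / sqrt (real N)) ^ N) \<longlonglongrightarrow> exp (- (\<beta>\<^sup>2) / 2)"
  unfolding power2_eq_square by real_asymp

text \<open>A point outside the limiting cone has a disc around it free of zeros of every late
  approximant, so the approximants stay bounded away from 0 there, and so does their limit.\<close>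

lemma roots_gauss_op:
  fixes p :: "complex poly"
  assumes alt: "alternating d p" and "p \<noteq> 0"
    and roots: "\<And>z. poly p z = 0 \<Longrightarrow> z \<in> circular_cone \<kappa>" and \<kappa>: "0 < \<kappa>" "\<kappa> \<le> 1"
    and "0 < \<alpha>" and zero: "poly (gauss_op \<alpha> p) z = 0"
  shows "z \<in> circular_cone (min 1 (exp (\<alpha>\<^sup>2 / 2) * \<kappa>))"
proof (rule ccontr)
  define \<mu> where "\<mu> = min 1 (exp (\<alpha>\<^sup>2 / 2) * \<kappa>)"
  assume "z \<notin> circular_cone (min 1 (exp (\<alpha>\<^sup>2 / 2) * \<kappa>))"
  then have "Re z < \<mu> * cmod z" "z \<noteq> 0"
    by (auto simp: circular_cone_def \<mu>_def)
  \<comment> \<open>The cone of \<open>\<nu>\<close> is slightly wider than that of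
    \<open>\<mu>\<close>, so it contains the cones of all late approximants while still missing
    \<open>z\<close>.\<close>
  then obtain \<nu> where \<nu>: "Re z / cmod z < \<nu>" "\<nu> < \<mu>"
    using dense[of "Re z / cmod z" \<mu>] by (auto simp: field_simps)
  then have "z \<in> - circular_cone \<nu>"
    using \<open>z \<noteq> 0\<close> by (simp add: circular_cone_def field_simps)
  then obtain \<epsilon> where \<epsilon>: "0 < \<epsilon>" "ball z \<epsilon> \<subseteq> - circular_cone \<nu>"
    using closed_circular_cone openE open_Compl by metis
  define s where "s N = \<alpha> / sqrt (real N)" for N :: nat
  define P where "P N = mult_op (\<lambda>k. cos (s N * real k) ^ N) p" for N
  have lim: "(\<lambda>N. cos (s N * real k) ^ N) \<longlonglongrightarrow> exp (- ((\<alpha> * real k)\<^sup>2) / 2)" for k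
    using cos_div_sqrt_power_tendsto[of "\<alpha> * real k"] by (simp add: s_def)
  \<comment> \<open>The case \<open>k = 1\<close> of \<open>lim\<close> is the factor by which the
    cone parameter grows.\<close>
  have "(\<lambda>N. min 1 (\<kappa> / cos (s N) ^ N)) \<longlonglongrightarrow> min 1 (\<kappa> / exp (- (\<alpha>\<^sup>2) / 2))"
    using lim[of 1] by (intro tendsto_intros) auto
  also have "min 1 (\<kappa> / exp (- (\<alpha>\<^sup>2) / 2)) = \<mu>"
    by (simp add: \<mu>_def exp_minus field_simps)
  finally have ev1: "\<forall>\<^sub>F N in sequentially. \<nu> < min 1 (\<kappa> / cos (s N) ^ N)"
    using \<nu>(2) by (rule order_tendstoD)
  have s0: "s \<longlonglongrightarrow> 0"
    unfolding s_def using \<open>0 < \<alpha>\<close> by real_asymp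
  then have ev2: "\<forall>\<^sub>F N in sequentially. s N < pi / 2"
    by (rule order_tendstoD) simp
  have "(\<lambda>N. s N * real (degree p)) \<longlonglongrightarrow> 0 * real (degree p)"
    by (intro tendsto_intros s0)
  then have ev3: "\<forall>\<^sub>F N in sequentially. s N * real (degree p) < pi / 2"
    by (rule order_tendstoD) simp
  \<comment> \<open>Keeps the leading coefficient nonzero, so that the approximants have the degree
    of \<open>p\<close>.\<close>
  have ev4: "\<forall>\<^sub>F N in sequentially. cos (s N * real (degree p)) ^ N > 0"
    using lim by (rule order_tendstoD) simp
  have "\<forall>\<^sub>F N in sequentially. cmod (coeff (P N) (degree p)) * \<epsilon> ^ degree p \<le> cmod (poly (P N) z)"
    using ev1 ev2 ev3 ev4 eventually_gt_at_top[of 0]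
  proof eventually_elim
    case (elim N)
    have "degree (P N) = degree p"
      unfolding P_def using elim(4) by (intro degree_mult_op) linarith
    moreover have "\<epsilon> \<le> dist z w" if "poly (P N) w = 0" for w
    proof -
      \<comment> \<open>Here \<open>N > 0\<close> matters: division by zero makes \<open>s 0\<close>
        equal to 0.\<close>
      have "0 < s N" using elim \<open>0 < \<alpha>\<close> by (simp add: s_def)
      then have "w \<in> circular_cone (min 1 (\<kappa> / cos (s N) ^ N))"
        using alt \<open>p \<noteq> 0\<close> roots \<kappa> elim that unfolding P_def
        by (intro roots_mult_op_cos_power[of d p]) auto
      then have "w \<in> circular_cone \<nu>"
        using circular_cone_antimono elim(1) by (meson less_imp_le subsetD)
      then show ?thesis using \<epsilon> by (meson ComplD mem_ball not_le subsetD)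
    qed
    ultimately show ?case
      using norm_poly_ge_dist_power[of "P N" \<epsilon> z] \<epsilon> by simp
  qed
  moreover have "(\<lambda>N. cmod (coeff (P N) (degree p)) * \<epsilon> ^ degree p) \<longlonglongrightarrow>
      cmod (coeff (gauss_op \<alpha> p) (degree p)) * \<epsilon> ^ degree p"
    unfolding gauss_op_eq_mult_op P_def coeff_mult_op by (intro tendsto_intros lim)
  moreover have "(\<lambda>N. cmod (poly (P N) z)) \<longlonglongrightarrow> cmod (poly (gauss_op \<alpha> p) z)"
    unfolding gauss_op_eq_mult_op P_def poly_mult_op by (intro tendsto_intros lim)
  ultimately have "cmod (coeff (gauss_op \<alpha> p) (degree p)) * \<epsilon> ^ degree p \<le> cmod (poly (gauss_op \<alpha> p) z)"
    by (intro tendsto_le[OF sequentially_bot])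
  moreover have "coeff (gauss_op \<alpha> p) (degree p) \<noteq> 0"
    using \<open>p \<noteq> 0\<close> by (simp add: gauss_op_eq_mult_op)
  then have "0 < cmod (coeff (gauss_op \<alpha> p) (degree p)) * \<epsilon> ^ degree p"
    using \<epsilon> by simp
  ultimately show False using zero by simp
qed

section \<open>The sector bound for the given factorization\<close>

theorem theorem2p5:
  fixes m n :: nat
    and c :: real
    and x a b :: "nat \<Rightarrow> real"
    and \<theta> \<alpha> :: real
    and p :: "complex poly"
  assumes "c \<noteq> 0"
    and "\<And>k. k \<in> {1..m} \<Longrightarrow> x k \<ge> 0"
    and "\<And>k. k \<in> {1..n} \<Longrightarrow> a k > 0"
    and "\<And>k. k \<in> {1..n} \<Longrightarrow> b k > 0"
    and "p = smult (complex_of_real c)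
               ((\<Prod>k=1..m. [:- complex_of_real (x k), 1:]) *
                (\<Prod>k=1..n. [:- complex_of_real (a k), 1:]\<^sup>2 + [:(complex_of_real (b k))\<^sup>2:]))"
    and "0 \<le> \<theta>" and "\<theta> < pi / 2"
    and "\<And>z. poly p z = 0 \<Longrightarrow> z \<in> sector \<theta>"
  shows "\<forall>z. poly (gauss_op \<alpha> p) z = 0 \<longrightarrow>
             z \<in> sector (arccos (min 1 (exp (\<alpha>\<^sup>2 / 2) * cos \<theta>)))"
proof (intro allI impI)
  fix z assume zero: "poly (gauss_op \<alpha> p) z = 0"
  \<comment> \<open>The factor \<open>c\<close> is split off because a negative \<open>c\<close>
    would reverse the sign pattern; it does not affect the zeros.\<close>
  define q where "q = (\<Prod>k=1..m. [:- complex_of_real (x k), 1:]) *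
    (\<Prod>k=1..n. [:- complex_of_real (a k), 1:]\<^sup>2 + [:(complex_of_real (b k))\<^sup>2:])"
  define \<mu> where "\<mu> = min 1 (exp (\<alpha>\<^sup>2 / 2) * cos \<theta>)"
  have p: "p = smult (complex_of_real c) q"
    using assms(5) by (simp add: q_def)
  have alt: "alternating ((\<Sum>k=1..m. 1) + (\<Sum>k=1..n. 2)) q"
    unfolding q_def using assms(2,3)
    by (intro alternating_mult alternating_prod alternating_linear alternating_quadratic)
       (auto intro: less_imp_le)
  have "[:- complex_of_real (a k), 1:]\<^sup>2 + [:(complex_of_real (b k))\<^sup>2:] \<noteq> 0" for k
    by (simp add: power2_eq_square)
  then have "q \<noteq> 0"
    by (simp add: q_def)
  have cos: "0 < cos \<theta>"
    using assms by (intro cos_gt_zero_pi) auto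
  have zero_q: "poly (gauss_op \<alpha> q) z = 0"
    using zero \<open>c \<noteq> 0\<close> by (simp add: p gauss_op_eq_mult_op mult_op_smult)
  have roots: "w \<in> circular_cone (cos \<theta>)" if "poly q w = 0" for w
    using assms(6,7) assms(8)[of w] that by (simp add: p sector_eq_circular_cone)
  have "z \<in> circular_cone \<mu>"
  \<comment> \<open>The limit argument is stated for positive parameters: for 0 the operator is the
    identity, and otherwise it is even in \<open>\<alpha>\<close>.\<close>
  proof (cases "\<alpha> = 0")
    case True
    then have "gauss_op \<alpha> q = q"
      by (intro poly_eqI) (simp add: gauss_op_eq_mult_op)
    then show ?thesis using roots[of z] zero_q True by (simp add: \<mu>_def min_absorb2)
  next
    case False
    have "gauss_op \<alpha> q = gauss_op \<bar>\<alpha>\<bar> q" by (simp add: gauss_op_def)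
    then show ?thesis
      using roots_gauss_op[OF alt \<open>q \<noteq> 0\<close> roots cos, of "\<bar>\<alpha>\<bar>" z] zero_q False
      by (simp add: \<mu>_def)
  qed
  \<comment> \<open>These bounds place \<open>\<mu>\<close> in the domain of \<open>arccos\<close>,
    so that \<open>cos (arccos \<mu>)\<close> is \<open>\<mu>\<close>.\<close>
  moreover have "0 < \<mu>" "\<mu> \<le> 1"
    using cos by (simp_all add: \<mu>_def)
  ultimately show "z \<in> sector (arccos (min 1 (exp (\<alpha>\<^sup>2 / 2) * cos \<theta>)))"
    by (simp add: sector_eq_circular_cone arccos_lbound arccos_ubound flip: \<mu>_def)
qed

end
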